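(* Let $\mathcal{H}$ be a real Hilbert space, let $T:\mathcal{H}\to\mathcal{H}$ be a nonexpansive mapping such that $\operatorname{Fix}T\neq\emptyset$, let $\lambda:[0,+\infty)\to[0,1]$ be a Lebesgue measurable function and let $x_0\in\mathcal{H}$. Suppose that $$0<\inf_{t\ge0}\lambda(t)\le\sup_{t\ge0}\lambda(t)<1.$$ Let $x:[0,+\infty)\to\mathcal{H}$ be the unique strong global solution of $$\dot x(t)=\lambda(t)\big(T(x(t))-x(t)\big),\qquad x(0)=x_0.$$ Then for all $t\ge0$ we have $$t\|\dot x(t)\|^2\le t\|T(x(t))-x(t)\|^2\le\frac{2}{\underline{\tau}}\int_{t/2}^t\lambda(s)(1-\lambda(s))\|T(x(s))-x(s)\|^2\,ds,$$ where $\underline{\tau}=\inf_{t\ge0}\lambda(t)(1-\lambda(t))>0$, and $$\lim_{t\to+\infty}\int_{t/2}^t\lambda(s)(1-\lambda(s))\|T(x(s))-x(s)\|^2\,ds=0.$$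
   Context: $T$ is nonexpansive if $\|Tx-Ty\|\le\|x-y\|$ for all $x,y\in\mathcal{H}$; $\operatorname{Fix}T=\{x\in\mathcal{H}:Tx=x\}$. A strong global solution of the system is a function $x:[0,+\infty)\to\mathcal{H}$ which is absolutely continuous on each interval $[0,b]$, $0<b<+\infty$ (i.e. on $[0,b]$ it is the sum of a constant and the indefinite integral of an integrable $\mathcal{H}$-valued function), satisfies $\dot x(t)=\lambda(t)\big(T(x(t))-x(t)\big)$ for almost all $t\ge0$, and satisfies $x(0)=x_0$. Such a solution exists and is unique. The derivative $\dot x(t)$ exists for almost all $t\ge 0$; statements about $\dot x(t)$ are understood for those $t$ at which the derivative exists. *)

theory Defs
  imports "HOL-Analysis.Analysis"
begin

(* The library's has_bochner_integral requires a second countable target, i.e. a separable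
   Hilbert space.  The following is the same definition without this restriction.  No
   measurability is lost: each s i takes finitely many values on measurable sets, so
   norm (f x - s i x) is measurable, and a subsequence of s converges to f almost everywhere. *)
definition has_bochner_int ::
    "'a measure \<Rightarrow> ('a \<Rightarrow> 'b::real_normed_vector) \<Rightarrow> 'b \<Rightarrow> bool" where
  "has_bochner_int M f v \<longleftrightarrow>
     f \<in> borel_measurable M \<and>
     (\<exists>s. (\<forall>i. Bochner_Integration.simple_bochner_integrable M (s i)) \<and>
          (\<lambda>i. \<integral>\<^sup>+x. ennreal (norm (f x - s i x)) \<partial>M) \<longlonglongrightarrow> 0 \<and>
          (\<lambda>i. Bochner_Integration.simple_bochner_integral M (s i)) \<longlonglongrightarrow> v)"

lemma has_bochner_int_eq_has_bochner_integral:
  fixes f :: "'a \<Rightarrow> 'b::{real_normed_vector, second_countable_topology}"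
  shows "has_bochner_int M f v \<longleftrightarrow> has_bochner_integral M f v"
  unfolding has_bochner_int_def has_bochner_integral.simps by auto

(* Integrability of f on the whole of {a..b} is the instance t = b. *)
definition abs_cont_on_interval ::
    "real \<Rightarrow> real \<Rightarrow> (real \<Rightarrow> 'b::real_normed_vector) \<Rightarrow> bool" where
  "abs_cont_on_interval a b x \<longleftrightarrow>
     (\<exists>c f. \<forall>t\<in>{a..b}. has_bochner_int (lebesgue_on {a..t}) f (x t - c))"

definition nonexpansive :: "('b::real_normed_vector \<Rightarrow> 'b) \<Rightarrow> bool" where
  "nonexpansive T \<longleftrightarrow> (\<forall>x y. norm (T x - T y) \<le> norm (x - y))"

definition Fix :: "('b \<Rightarrow> 'b) \<Rightarrow> 'b set" where
  "Fix T = {x. T x = x}"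

(* Functions on [0, oo) are total functions on the reals of which only the values on {0..}
   are used; in particular the derivative at 0 is one-sided. *)
definition strong_global_solution ::
    "(real \<Rightarrow> real) \<Rightarrow> ('b::real_normed_vector \<Rightarrow> 'b) \<Rightarrow> 'b \<Rightarrow> (real \<Rightarrow> 'b) \<Rightarrow> bool" where
  "strong_global_solution lam T x0 x \<longleftrightarrow>
     (\<forall>b>0. abs_cont_on_interval 0 b x) \<and>
     (AE t in lebesgue_on {0..}.
        (x has_vector_derivative lam t *\<^sub>R (T (x t) - x t)) (at t within {0..})) \<and>
     x 0 = x0"

end

theory Submission
  imports Defs
begin

text \<open>Write \<open>y = T x - x\<close>. Each estimate has the form \<open>\<phi> (x b) \<le> \<phi> (x a) + c * (b - a)\<close> with
  \<open>\<phi>\<close> Lipschitz, and follows from the Euler-step inequality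
  \<open>\<phi> (x t + h * lam t * y t) \<le> \<phi> (x t) + c * h\<close>, because the Euler step agrees with
  the solution up to \<open>o(h)\<close> for almost every \<open>t\<close>. Taking for \<open>\<phi> u\<close> the residual \<open>norm (T u - u)\<close> shows
  that \<open>norm y\<close> is nonincreasing; \<open>norm (u - x s)\<close> bounds the speed of \<open>x\<close>; and \<open>(norm (u - p))\<^sup>2\<close> for a
  fixed point \<open>p\<close> shows that \<open>E t = (norm (x t - p))\<^sup>2\<close> decreases at a rate of at least
  \<open>\<tau> * (norm (y t))\<^sup>2\<close> up to time \<open>t\<close>. Hence \<open>t * (norm (y t))\<^sup>2\<close> is at most
  \<open>2 / \<tau> * (E (t/2) - E t)\<close>, which tends to 0 as \<open>E\<close> converges.\<close>

section \<open>Scalar consequences of the vector-valued integral\<close>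

text \<open>Pairing with a vector of norm at most 1 is linear and does not increase norms, so it
  carries the approximating simple functions of \<open>f\<close> to approximating simple functions
  of the scalar function. This gives access to the library's theory of real integrals in a possibly
  nonseparable space.\<close>

lemma has_bochner_int_inner:
  fixes f :: "'a \<Rightarrow> 'b::real_inner"
  assumes "has_bochner_int M f v" and h: "norm h \<le> 1"
  shows "has_bochner_integral M (\<lambda>u. f u \<bullet> h) (v \<bullet> h)"
proof -
  obtain s where f: "f \<in> borel_measurable M"
    and s: "\<And>i. Bochner_Integration.simple_bochner_integrable M (s i)"
    and lim: "(\<lambda>i. \<integral>\<^sup>+u. ennreal (norm (f u - s i u)) \<partial>M) \<longlonglongrightarrow> 0"
    and v: "(\<lambda>i. Bochner_Integration.simple_bochner_integral M (s i)) \<longlonglongrightarrow> v"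
    using assms(1) unfolding has_bochner_int_def by blast
  have lin: "linear (\<lambda>u::'b. u \<bullet> h)"
    using bounded_linear_inner_left by (rule bounded_linear.linear)
  show ?thesis
  proof (rule has_bochner_integral.intros[where s = "\<lambda>i u. s i u \<bullet> h"])
    show "(\<lambda>u. f u \<bullet> h) \<in> borel_measurable M"
      by (rule measurable_compose[OF f]) (intro borel_measurable_continuous_onI continuous_intros)
    show "Bochner_Integration.simple_bochner_integrable M (\<lambda>u. s i u \<bullet> h)" for i
      using s by (intro simple_bochner_integrable_compose2[where p = "\<lambda>x y. x \<bullet> h" and g = "s i"]) auto
    have "(\<integral>\<^sup>+u. ennreal (norm (f u \<bullet> h - s i u \<bullet> h)) \<partial>M) \<le> (\<integral>\<^sup>+u. ennreal (norm (f u - s i u)) \<partial>M)" for i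
    proof (intro nn_integral_mono ennreal_leI)
      fix u
      have "norm ((f u - s i u) \<bullet> h) \<le> norm (f u - s i u) * norm h"
        by (simp add: Cauchy_Schwarz_ineq2)
      also have "\<dots> \<le> norm (f u - s i u)"
        using h by (simp add: mult_left_le)
      finally show "norm (f u \<bullet> h - s i u \<bullet> h) \<le> norm (f u - s i u)"
        by (simp add: inner_diff_left)
    qed
    then show "(\<lambda>i. \<integral>\<^sup>+u. ennreal (norm (f u \<bullet> h - s i u \<bullet> h)) \<partial>M) \<longlonglongrightarrow> 0"
      by (intro tendsto_sandwich[OF _ _ tendsto_const lim] always_eventually allI) auto
    show "(\<lambda>i. Bochner_Integration.simple_bochner_integral M (\<lambda>u. s i u \<bullet> h)) \<longlonglongrightarrow> v \<bullet> h"
      unfolding simple_bochner_integral_linear[OF lin s] by (intro tendsto_intros v)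
  qed
qed

text \<open>The approximation error \<open>norm (f u - s u)\<close> need not be measurable in a nonseparable space,
  so the triangle inequality is applied to the measurable function \<open>norm (f u) - norm (s u)\<close>.\<close>

lemma has_bochner_int_integrable_norm:
  fixes f :: "'a \<Rightarrow> 'b::real_normed_vector"
  assumes "has_bochner_int M f v"
  shows "integrable M (\<lambda>u. norm (f u))"
proof -
  obtain s where f: "f \<in> borel_measurable M"
    and s: "\<And>i. Bochner_Integration.simple_bochner_integrable M (s i)"
    and lim: "(\<lambda>i. \<integral>\<^sup>+u. ennreal (norm (f u - s i u)) \<partial>M) \<longlonglongrightarrow> 0"
    using assms unfolding has_bochner_int_def by blast
  \<comment> \<open>A single approximant at finite distance from \<open>f\<close> suffices, since
    simple integrable functions have integrable norm.\<close>
  obtain i where i: "(\<integral>\<^sup>+u. ennreal (norm (f u - s i u)) \<partial>M) < \<infinity>"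
    using order_tendstoD(2)[OF lim, of \<infinity>] by (auto simp: eventually_sequentially)
  have nf: "(\<lambda>u. norm (f u)) \<in> borel_measurable M"
    by (rule measurable_compose[OF f]) (intro borel_measurable_continuous_onI continuous_intros)
  have "Bochner_Integration.simple_bochner_integrable M (\<lambda>u. norm (s i u))"
    using s by (intro simple_bochner_integrable_compose2[where p = "\<lambda>x y. norm x" and g = "s i"]) auto
  then have ns: "integrable M (\<lambda>u. norm (s i u))"
    using has_bochner_integral_simple_bochner_integrable integrable.intros by blast
  have "integrable M (\<lambda>u. norm (f u) - norm (s i u))"
  proof (rule integrableI_bounded)
    have "(\<integral>\<^sup>+u. ennreal (norm (norm (f u) - norm (s i u))) \<partial>M)
        \<le> (\<integral>\<^sup>+u. ennreal (norm (f u - s i u)) \<partial>M)"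
      by (intro nn_integral_mono ennreal_leI) (simp add: norm_triangle_ineq3)
    with i show "(\<integral>\<^sup>+u. ennreal (norm (norm (f u) - norm (s i u))) \<partial>M) < \<infinity>"
      by (rule le_less_trans[rotated])
  qed (use nf ns in measurable)
  from Bochner_Integration.integrable_add[OF this ns] show ?thesis
    by simp
qed

text \<open>The majorant \<open>F\<close> is the norm of the density \<open>f\<close>. Pairing with
  the direction of the increment turns the vector inequality into a comparison of two real
  integrals.\<close>

lemma abs_cont_on_interval_norm_diff_le:
  fixes x :: "real \<Rightarrow> 'b::real_inner"
  assumes "abs_cont_on_interval a b x" and "a \<le> b"
  obtains F where "F absolutely_integrable_on {a..b}" and "\<And>t. 0 \<le> F t"
    and "\<And>s t. a \<le> s \<Longrightarrow> s \<le> t \<Longrightarrow> t \<le> b \<Longrightarrow> norm (x t - x s) \<le> integral {s..t} F"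
proof -
  obtain c f where f: "\<And>t. t \<in> {a..b} \<Longrightarrow> has_bochner_int (lebesgue_on {a..t}) f (x t - c)"
    using assms(1) unfolding abs_cont_on_interval_def by blast
  define F where "F u = norm (f u)" for u
  have F: "F absolutely_integrable_on {a..b}"
    using has_bochner_int_integrable_norm[OF f[of b]] \<open>a \<le> b\<close>
    by (simp add: F_def[abs_def] set_integrable_def integrable_restrict_space)
  moreover have "norm (x t - x s) \<le> integral {s..t} F" if st: "a \<le> s" "s \<le> t" "t \<le> b" for s t
  proof -
    \<comment> \<open>Pairing the increment with \<open>h\<close> returns its norm. If the increment
      vanishes, \<open>sgn\<close> gives 0 and both sides are 0.\<close>
    define h where "h = sgn (x t - x s)"
    have h: "norm h \<le> 1"
      by (simp add: h_def norm_sgn)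
    have hi: "((\<lambda>u. f u \<bullet> h) has_integral (x r - c) \<bullet> h) {a..r}" if "r \<in> {a..b}" for r
      using has_bochner_int_inner[OF f[OF that] h] has_integral_integral_lebesgue_on[of "{a..r}" "\<lambda>u. f u \<bullet> h"]
      by (auto simp: has_bochner_integral_iff)
    have intg: "(\<lambda>u. f u \<bullet> h) integrable_on {s..t}"
      using hi[of t] st by (auto intro: integrable_on_subinterval has_integral_integrable)
    have "integral {a..s} (\<lambda>u. f u \<bullet> h) + integral {s..t} (\<lambda>u. f u \<bullet> h) = integral {a..t} (\<lambda>u. f u \<bullet> h)"
      using hi[of t] st by (intro Henstock_Kurzweil_Integration.integral_combine) auto
    then have "integral {s..t} (\<lambda>u. f u \<bullet> h) = (x t - x s) \<bullet> h"
      using hi[of t] hi[of s] st by (simp add: integral_unique inner_diff_left)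
    also have "\<dots> = norm (x t - x s)"
      by (cases "x t = x s")
        (auto simp: h_def sgn_div_norm power2_norm_eq_inner[symmetric] power2_eq_square)
    finally have "norm (x t - x s) = integral {s..t} (\<lambda>u. f u \<bullet> h)" ..
    also have "\<dots> \<le> integral {s..t} F"
    proof (rule integral_le[OF intg])
      show "F integrable_on {s..t}"
        using absolutely_integrable_on_subinterval[OF F] st
        by (auto intro: set_lebesgue_integral_eq_integral)
      show "f u \<bullet> h \<le> F u" for u
        using norm_cauchy_schwarz[of "f u" h] mult_left_le[OF h norm_ge_zero[of "f u"]]
        unfolding F_def by linarith
    qed
    finally show ?thesis .
  qed
  moreover have "0 \<le> F t" for t
    by (simp add: F_def)
  ultimately show ?thesis
    using that by blast
qed

section \<open>Monotonicity from a one-sided growth condition off a null set\<close>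

lemma absolutely_integrable_on_open_Int:
  fixes F :: "'a::euclidean_space \<Rightarrow> 'b::euclidean_space"
  assumes "F absolutely_integrable_on S" and "open U"
  shows "F absolutely_integrable_on (U \<inter> S)"
proof -
  have "set_integrable lebesgue U (\<lambda>u. indicator S u *\<^sub>R F u)"
    using assms unfolding set_integrable_def
    by (simp only: integrable_mult_indicator borel_open sets_completionI_sets sets_lborel)
  then show ?thesis
    by (simp add: set_integrable_def indicator_inter_arith)
qed

text \<open>Open sets exceeding \<open>N\<close> by less and less measure intersect in a null set,
  so by dominated convergence the integrals of \<open>F\<close> over their finite intersections tend
  to 0.\<close>

lemma negligible_small_integral_open:
  fixes F :: "real \<Rightarrow> real"
  assumes F: "F absolutely_integrable_on S" and "negligible N" and "0 < e"
  obtains U where "open U" "N \<subseteq> U" "integral (U \<inter> S) F < e"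
proof -
  have "\<exists>U. open U \<and> N \<subseteq> U \<and> emeasure lebesgue (U - N) < ennreal (inverse (Suc n))" for n
    using sets_lebesgue_outer_open[of N "inverse (Suc n)"] \<open>negligible N\<close>
    by (metis inverse_positive_iff_positive negligible_imp_sets of_nat_0_less_iff zero_less_Suc)
  then obtain U where U: "\<And>n. open (U n)" "\<And>n. N \<subseteq> U n"
    "\<And>n. emeasure lebesgue (U n - N) < ennreal (inverse (Suc n))"
    by metis
  \<comment> \<open>Finite intersections remain open and decrease to \<open>W\<close>, which itself
    need not be open.\<close>
  define V where "V n = (\<Inter>k\<le>n. U k)" for n
  define W where "W = (\<Inter>n. U n)"
  have oV: "open (V n)" for n
    unfolding V_def using U by auto
  have sW: "W \<in> sets lebesgue"
    unfolding W_def using U(1) by (intro sets.countable_INT'') auto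
  have sN: "N \<in> sets lebesgue"
    using \<open>negligible N\<close> by (rule negligible_imp_sets)
  have "emeasure lebesgue (W - N) \<le> 0"
  proof (rule LIMSEQ_le_const)
    have "(\<lambda>n. inverse (real (Suc n))) \<longlonglongrightarrow> 0"
      by (rule LIMSEQ_inverse_real_of_nat)
    then show "(\<lambda>n. ennreal (inverse (real (Suc n)))) \<longlonglongrightarrow> 0"
      using tendsto_ennrealI by fastforce
    have "emeasure lebesgue (W - N) \<le> ennreal (inverse (Suc n))" for n
    proof -
      have "emeasure lebesgue (W - N) \<le> emeasure lebesgue (U n - N)"
        using U(1)[of n] sN by (intro emeasure_mono) (auto simp: W_def)
      then show ?thesis
        using U(3)[of n] by simp
    qed
    then show "\<exists>m. \<forall>n\<ge>m. emeasure lebesgue (W - N) \<le> ennreal (inverse (real (Suc n)))"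
      by blast
  qed
  then have "negligible (W - N)"
    using sW sN by (auto simp: negligible_iff_null_sets intro!: null_setsI)
  then have nW: "negligible W"
    using \<open>negligible N\<close> by (rule negligible_subset[OF negligible_Un]) auto
  have int: "(\<lambda>u. if u \<in> V n then F u else 0) integrable_on S" for n
    using absolutely_integrable_on_open_Int[OF F oV]
    by (simp add: Henstock_Kurzweil_Integration.integrable_restrict_Int set_lebesgue_integral_eq_integral)
  have "(\<lambda>n. integral S (\<lambda>u. if u \<in> V n then F u else 0)) \<longlonglongrightarrow> integral S (\<lambda>u. if u \<in> W then F u else 0)"
  proof (rule dominated_convergence(2)[OF int, where h = "\<lambda>u. \<bar>F u\<bar>"])
    show "(\<lambda>u. \<bar>F u\<bar>) integrable_on S"
      using F by (simp add: absolutely_integrable_on_def)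
    show "(\<lambda>n. if u \<in> V n then F u else 0) \<longlonglongrightarrow> (if u \<in> W then F u else 0)" for u
    proof (cases "u \<in> W")
      case True
      then have "u \<in> V n" for n by (auto simp: V_def W_def)
      with True show ?thesis by simp
    next
      case False
      then obtain m where "u \<notin> U m" by (auto simp: W_def)
      then have "\<forall>n\<ge>m. (if u \<in> V n then F u else 0) = 0" by (auto simp: V_def)
      then have "eventually (\<lambda>n. (if u \<in> V n then F u else 0) = 0) sequentially"
        unfolding eventually_sequentially by blast
      with False show ?thesis by (simp add: tendsto_eventually)
    qed
  qed auto
  moreover have "integral S (\<lambda>u. if u \<in> W then F u else 0) = 0"
    using integral_spike[OF nW, of S "\<lambda>u. if u \<in> W then F u else 0" "\<lambda>_. 0"] by simp
  ultimately have "(\<lambda>n. integral (V n \<inter> S) F) \<longlonglongrightarrow> 0"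
    by (simp add: Henstock_Kurzweil_Integration.integral_restrict_Int)
  then obtain n where "integral (V n \<inter> S) F < e"
    using order_tendstoD(2)[OF _ \<open>0 < e\<close>] by (metis (no_types, lifting) eventually_sequentially order_refl)
  moreover have "N \<subseteq> V n"
    using U(2) by (auto simp: V_def)
  ultimately show ?thesis
    using oV that by blast
qed

text \<open>The points where \<open>G\<close> is at most \<open>G a\<close> form a compact set. Its
  largest element must be \<open>b\<close>, because from any earlier one the local condition leads
  to a larger element.\<close>

lemma right_local_nonincreasing_imp_le:
  fixes G :: "real \<Rightarrow> real"
  assumes "a \<le> b" and G: "continuous_on {a..b} G"
    and loc: "\<And>t. a \<le> t \<Longrightarrow> t < b \<Longrightarrow> \<forall>\<^sub>F s in at_right t. G s \<le> G t"
  shows "G b \<le> G a"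
proof -
  define C where "C = {t \<in> {a..b}. G t \<le> G a}"
  have "closed C"
    unfolding C_def using G by (intro continuous_on_closed_Collect_le continuous_intros) auto
  moreover have "C \<subseteq> {a..b}"
    by (auto simp: C_def)
  ultimately have "compact C"
    using compact_Int_closed[of "{a..b}" C] by (simp add: Int_absorb1)
  moreover have "a \<in> C"
    using \<open>a \<le> b\<close> by (simp add: C_def)
  ultimately obtain c where c: "c \<in> C" "\<And>t. t \<in> C \<Longrightarrow> t \<le> c"
    using compact_attains_sup[of C] by blast
  have "\<not> c < b"
  proof
    assume "c < b"
    moreover have "a \<le> c"
      using c(1) by (simp add: C_def)
    ultimately have "\<forall>\<^sub>F s in at_right c. G s \<le> G c \<and> c < s \<and> s < b"
      by (intro eventually_conj loc eventually_at_right_less)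
        (auto intro: eventually_at_rightI[of c b])
    then obtain s where "G s \<le> G c" "c < s" "s < b"
      using eventually_happens' trivial_limit_at_right_real by blast
    then have "s \<in> C"
      using c(1) by (auto simp: C_def)
    with c(2) \<open>c < s\<close> show False
      by force
  qed
  with c(1) show ?thesis
    by (auto simp: C_def)
qed

text \<open>On an open set \<open>U\<close> covering the exceptional set, the growth of \<open>g\<close> is paid for by the
  integral of \<open>F\<close> over \<open>U\<close>, which is arbitrarily small.\<close>

lemma AE_right_Dini_nonpos_imp_le:
  fixes g F :: "real \<Rightarrow> real"
  assumes "a \<le> b" and F: "F absolutely_integrable_on {a..b}" and F0: "\<And>t. t \<in> {a..b} \<Longrightarrow> 0 \<le> F t"
    and g: "\<And>s t. a \<le> s \<Longrightarrow> s \<le> t \<Longrightarrow> t \<le> b \<Longrightarrow> \<bar>g t - g s\<bar> \<le> integral {s..t} F"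
    and N: "negligible N"
    and Dini: "\<And>t e. a \<le> t \<Longrightarrow> t < b \<Longrightarrow> t \<notin> N \<Longrightarrow> 0 < e \<Longrightarrow>
      \<forall>\<^sub>F s in at_right t. g s - g t \<le> e * (s - t)"
  shows "g b \<le> g a"
proof -
  have Fi: "F integrable_on {a..b}"
    using F by (rule set_lebesgue_integral_eq_integral)
  have cI: "continuous_on {a..b} (\<lambda>t. integral {a..t} F)"
    using Fi by (rule indefinite_integral_continuous_1)
  have contg: "continuous_on {a..b} g"
    unfolding continuous_on_iff
  proof (intro ballI allI impI)
    fix t e :: real assume t: "t \<in> {a..b}" and "0 < e"
    then obtain d where d: "d > 0"
      "\<And>s. s \<in> {a..b} \<Longrightarrow> dist s t < d \<Longrightarrow> dist (integral {a..s} F) (integral {a..t} F) < e"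
      using cI unfolding continuous_on_iff by meson
    have "dist (g s) (g t) < e" if s: "s \<in> {a..b}" "dist s t < d" for s
    proof -
      have le: "\<bar>g w - g v\<bar> \<le> integral {a..w} F - integral {a..v} F" if "a \<le> v" "v \<le> w" "w \<le> b" for v w
      proof -
        have "integral {a..v} F + integral {v..w} F = integral {a..w} F"
          using that Fi
          by (intro Henstock_Kurzweil_Integration.integral_combine) (auto intro: integrable_on_subinterval)
        with g[OF that] show ?thesis by simp
      qed
      have "\<bar>g s - g t\<bar> \<le> \<bar>integral {a..s} F - integral {a..t} F\<bar>"
        using le[of s t] le[of t s] s t by (cases "s \<le> t") auto
      then show ?thesis
        using d(2)[OF s] by (simp add: dist_real_def)
    qed
    with d show "\<exists>d>0. \<forall>s\<in>{a..b}. dist s t < d \<longrightarrow> dist (g s) (g t) < e"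
      by blast
  qed
  have main: "g b - g a \<le> e * (b - a) + e" if e: "0 < e" for e
  proof -
    obtain U where U: "open U" "N \<subseteq> U" "integral (U \<inter> {a..b}) F < e"
      using negligible_small_integral_open[OF F N e] .
    define FU where "FU u = (if u \<in> U then F u else 0)" for u
    have FUi: "FU integrable_on {a..b}"
      unfolding FU_def using absolutely_integrable_on_open_Int[OF F U(1)]
      by (simp add: Henstock_Kurzweil_Integration.integrable_restrict_Int set_lebesgue_integral_eq_integral)
    \<comment> \<open>Two penalties make \<open>G\<close> locally nonincreasing to the right: at
      points of \<open>U\<close> the integral of \<open>FU\<close> absorbs the growth of
      \<open>g\<close>, and at all other points, which lie outside \<open>N\<close>, the slope
      \<open>e\<close> does.\<close>
    define G where "G t = g t - e * (t - a) - integral {a..t} FU" for t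
    have "G b \<le> G a"
    proof (rule right_local_nonincreasing_imp_le[OF \<open>a \<le> b\<close>])
      show "continuous_on {a..b} G"
        unfolding G_def by (intro continuous_intros contg indefinite_integral_continuous_1 FUi)
      fix t assume t: "a \<le> t" "t < b"
      have split: "integral {a..s} FU = integral {a..t} FU + integral {t..s} FU" if "t \<le> s" "s \<le> b" for s
        using that t FUi
        by (intro Henstock_Kurzweil_Integration.integral_combine[symmetric])
          (auto intro: integrable_on_subinterval)
      have right: "\<forall>\<^sub>F s in at_right t. t < s \<and> s < b"
        using t by (intro eventually_conj eventually_at_right_less eventually_at_rightI[of t b]) auto
      show "\<forall>\<^sub>F s in at_right t. G s \<le> G t"
      proof (cases "t \<in> U")
        case True
        then obtain d where d: "d > 0" "ball t d \<subseteq> U"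
          using U(1) open_contains_ball by blast
        have "\<forall>\<^sub>F s in at_right t. s < t + d"
          using d(1) by (intro eventually_at_rightI[of t "t + d"]) auto
        with right show ?thesis
        proof eventually_elim
          case (elim s)
          have "integral {t..s} FU = integral {t..s} F"
            using elim d(2) by (intro Henstock_Kurzweil_Integration.integral_cong)
              (auto simp: FU_def subset_iff dist_real_def)
          moreover have "g s - g t \<le> integral {t..s} F"
            using g[of t s] elim t by auto
          moreover have "e * (t - a) \<le> e * (s - a)"
            using elim e by simp
          ultimately show ?case
            using split[of s] elim by (simp add: G_def)
        qed
      next
        case False
        with U(2) have "t \<notin> N" by blast
        from right Dini[OF t this e] show ?thesis
        proof eventually_elim
          case (elim s)
          have "0 \<le> integral {t..s} FU"
            using elim t by (intro Henstock_Kurzweil_Integration.integral_nonneg)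
              (auto simp: FU_def F0 intro: integrable_on_subinterval[OF FUi])
          then show ?case
            using elim split[of s] by (simp add: G_def algebra_simps)
        qed
      qed
    qed
    moreover have "integral {a..b} FU = integral (U \<inter> {a..b}) F"
      unfolding FU_def by (rule Henstock_Kurzweil_Integration.integral_restrict_Int)
    ultimately show ?thesis
      using U(3) by (simp add: G_def)
  qed
  have "g b - g a \<le> 0 + e" if e: "0 < e" for e :: real
  proof -
    \<comment> \<open>With this value in place of \<open>e\<close>, the two error terms of
      \<open>main\<close> add up to exactly \<open>e\<close>.\<close>
    have "0 < e / (b - a + 1)"
      using e \<open>a \<le> b\<close> by simp
    from main[OF this] have "g b - g a \<le> e / (b - a + 1) * (b - a + 1)"
      by (simp add: distrib_left)
    then show ?thesis
      using \<open>a \<le> b\<close> by simp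
  qed
  then have "g b - g a \<le> 0"
    by (rule field_le_epsilon)
  then show ?thesis by simp
qed

section \<open>Comparison along strong solutions\<close>

text \<open>For almost every \<open>t\<close> the solution and the Euler step from
  \<open>x t\<close> differ by o(h), and \<open>\<phi>\<close> is Lipschitz on \<open>W\<close>, so
  the Euler inequality passes to an upper bound \<open>c\<close> for the right growth rate of
  \<open>\<phi>\<close> along \<open>x\<close>. The set \<open>W\<close> admits functions that are
  Lipschitz only on bounded sets, such as a squared distance.\<close>

lemma strong_global_solution_le:
  fixes x :: "real \<Rightarrow> 'b::real_inner" and \<phi> :: "'b \<Rightarrow> real"
  assumes sol: "strong_global_solution lam T x0 x" and "0 \<le> a" "a \<le> b"
    and W: "\<And>t. a \<le> t \<Longrightarrow> t \<le> b \<Longrightarrow> x t \<in> W"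
    and lip: "\<And>u v. u \<in> W \<Longrightarrow> v \<in> W \<Longrightarrow> \<bar>\<phi> u - \<phi> v\<bar> \<le> K * norm (u - v)"
    and stepW: "\<And>t h. a \<le> t \<Longrightarrow> t < b \<Longrightarrow> 0 < h \<Longrightarrow> h < 1 \<Longrightarrow>
      x t + (h * lam t) *\<^sub>R (T (x t) - x t) \<in> W"
    and step: "\<And>t h. a \<le> t \<Longrightarrow> t < b \<Longrightarrow> 0 < h \<Longrightarrow> h < 1 \<Longrightarrow>
      \<phi> (x t + (h * lam t) *\<^sub>R (T (x t) - x t)) \<le> \<phi> (x t) + c * h"
  shows "\<phi> (x b) \<le> \<phi> (x a) + c * (b - a)"
proof -
  have lip': "\<bar>\<phi> u - \<phi> v\<bar> \<le> \<bar>K\<bar> * norm (u - v)" if "u \<in> W" "v \<in> W" for u v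
    using lip[OF that] mult_right_mono[OF abs_ge_self[of K] norm_ge_zero[of "u - v"]] by linarith
  \<comment> \<open>The extra 1 makes the interval have positive length also when \<open>b\<close>
    is 0, as the definition of a solution demands.\<close>
  have "abs_cont_on_interval 0 (b + 1) x"
    using sol \<open>0 \<le> a\<close> \<open>a \<le> b\<close> by (simp add: strong_global_solution_def)
  then obtain F where F: "F absolutely_integrable_on {0..b + 1}" "\<And>t. 0 \<le> F t"
    "\<And>s t. 0 \<le> s \<Longrightarrow> s \<le> t \<Longrightarrow> t \<le> b + 1 \<Longrightarrow> norm (x t - x s) \<le> integral {s..t} F"
    using \<open>0 \<le> a\<close> \<open>a \<le> b\<close> by (elim abs_cont_on_interval_norm_diff_le) auto
  have "AE t in lebesgue_on {0..}.
      (x has_vector_derivative lam t *\<^sub>R (T (x t) - x t)) (at t within {0..})"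
    using sol by (simp add: strong_global_solution_def)
  then obtain N where N: "N \<in> null_sets (lebesgue_on {0..})"
    and der: "\<And>t. 0 \<le> t \<Longrightarrow> t \<notin> N \<Longrightarrow>
      (x has_vector_derivative lam t *\<^sub>R (T (x t) - x t)) (at t within {0..})"
    unfolding eventually_ae_filter by (auto simp: subset_iff)
  have nN: "negligible N"
    using N by (auto simp: null_sets_restrict_space negligible_iff_null_sets)
  define g where "g t = \<phi> (x t) - c * t" for t
  \<comment> \<open>Majorant for the increments of \<open>g\<close>: the Lipschitz bound for
    \<open>\<phi>\<close> along \<open>x\<close>, plus the linear term.\<close>
  define H where "H t = \<bar>K\<bar> * F t + \<bar>c\<bar>" for t
  have Fab: "F absolutely_integrable_on {a..b}"
    by (rule absolutely_integrable_on_subinterval[OF F(1)]) (use \<open>0 \<le> a\<close> in auto)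
  have "g b \<le> g a"
  proof (rule AE_right_Dini_nonpos_imp_le[OF \<open>a \<le> b\<close> _ _ _ nN])
    show "H absolutely_integrable_on {a..b}"
      unfolding H_def using Fab
      by (intro set_integral_add set_integrable_mult_right absolutely_integrable_on_const) auto
    show "0 \<le> H t" for t
      using F(2) by (simp add: H_def)
    show "\<bar>g t - g s\<bar> \<le> integral {s..t} H" if st: "a \<le> s" "s \<le> t" "t \<le> b" for s t
    proof -
      have "F integrable_on {s..t}"
        using absolutely_integrable_on_subinterval[OF Fab] st
        by (auto intro: set_lebesgue_integral_eq_integral)
      then have "integral {s..t} H = \<bar>K\<bar> * integral {s..t} F + \<bar>c\<bar> * (t - s)"
        unfolding H_def using st(2)
        by (subst Henstock_Kurzweil_Integration.integral_add) (auto intro: integrable_on_mult_right)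
      moreover have "\<bar>\<phi> (x t) - \<phi> (x s)\<bar> \<le> \<bar>K\<bar> * norm (x t - x s)"
        using st by (intro lip' W) auto
      moreover have "\<bar>K\<bar> * norm (x t - x s) \<le> \<bar>K\<bar> * integral {s..t} F"
        using F(3)[of s t] st \<open>0 \<le> a\<close> by (intro mult_left_mono) auto
      moreover have "\<bar>c * t - c * s\<bar> = \<bar>c\<bar> * (t - s)"
        using st(2) by (simp add: abs_mult flip: right_diff_distrib)
      ultimately show ?thesis
        unfolding g_def by linarith
    qed
    fix t e :: real
    assume t: "a \<le> t" "t < b" "t \<notin> N" and "0 < e"
    define v where "v = T (x t) - x t"
    \<comment> \<open>The added 1 keeps the denominator positive when \<open>K\<close> is 0.\<close>
    define e' where "e' = e / (\<bar>K\<bar> + 1)"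
    have "0 < e'"
      using \<open>0 < e\<close> by (simp add: e'_def)
    have "(x has_vector_derivative lam t *\<^sub>R v) (at t within {0..})"
      using der[of t] t \<open>0 \<le> a\<close> by (simp add: v_def)
    then obtain d where d: "d > 0" "\<And>s. 0 \<le> s \<Longrightarrow> \<bar>s - t\<bar> < d \<Longrightarrow>
        norm (x s - x t - (s - t) *\<^sub>R (lam t *\<^sub>R v)) \<le> e' * \<bar>s - t\<bar>"
      using \<open>0 < e'\<close> unfolding has_vector_derivative_def has_derivative_within_alt
      by (metis atLeast_iff real_norm_def)
    have "\<forall>\<^sub>F s in at_right t. t < s \<and> s < b \<and> s < t + d \<and> s < t + 1"
      using t d(1) by (intro eventually_conj eventually_at_right_less)
        (auto intro: eventually_at_rightI[of t b] eventually_at_rightI[of t "t + d"]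
          eventually_at_rightI[of t "t + 1"])
    then show "\<forall>\<^sub>F s in at_right t. g s - g t \<le> e * (s - t)"
    proof eventually_elim
      case (elim s)
      \<comment> \<open>The Euler step of length \<open>s - t\<close>, which is admissible because
        \<open>s < t + 1\<close>.\<close>
      define z where "z = x t + ((s - t) * lam t) *\<^sub>R v"
      have z: "z \<in> W" "\<phi> z \<le> \<phi> (x t) + c * (s - t)"
        using stepW[of t "s - t"] step[of t "s - t"] t elim by (auto simp: z_def v_def)
      have "norm (x s - z) \<le> e' * (s - t)"
        using d(2)[of s] elim t \<open>0 \<le> a\<close> by (simp add: z_def algebra_simps)
      have "\<phi> (x s) - \<phi> z \<le> \<bar>K\<bar> * norm (x s - z)"
        using lip'[OF W[of s] z(1)] elim t by auto
      also have "\<dots> \<le> (\<bar>K\<bar> + 1) * (e' * (s - t))"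
        using \<open>norm (x s - z) \<le> e' * (s - t)\<close> by (intro mult_mono) auto
      also have "\<dots> = e * (s - t)"
        by (simp add: e'_def)
      finally show ?case
        using z(2) by (simp add: g_def algebra_simps)
    qed
  qed
  then show ?thesis
    by (simp add: g_def algebra_simps)
qed

section \<open>One relaxation step of a nonexpansive map\<close>

text \<open>Passing through \<open>T u\<close> splits the new residual into two pieces, bounded by
  the fractions \<open>m\<close> and \<open>1 - m\<close> of the old one.\<close>

lemma nonexpansive_residual_relax_le:
  assumes "nonexpansive T" and "0 \<le> m" "m \<le> 1"
  shows "norm (T (u + m *\<^sub>R (T u - u)) - (u + m *\<^sub>R (T u - u))) \<le> norm (T u - u)"
proof -
  define z where "z = u + m *\<^sub>R (T u - u)"
  have "norm (T z - z) \<le> norm (T z - T u) + norm (T u - z)"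
    using norm_triangle_ineq[of "T z - T u" "T u - z"] by simp
  also have "norm (T z - T u) \<le> norm (z - u)"
    using assms by (simp add: nonexpansive_def)
  also have "\<dots> = m * norm (T u - u)"
    using assms by (simp add: z_def)
  also have "T u - z = (1 - m) *\<^sub>R (T u - u)"
    by (simp add: z_def algebra_simps)
  also have "m * norm (T u - u) + norm ((1 - m) *\<^sub>R (T u - u)) = norm (T u - u)"
    using assms by (simp add: left_diff_distrib)
  finally show ?thesis
    by (simp add: z_def)
qed

text \<open>The squared distance to \<open>p\<close> is a quadratic polynomial in \<open>m\<close>.
  Nonexpansiveness is the case of the full step, \<open>m = 1\<close>; it bounds the inner product
  in the linear coefficient, which then serves for every \<open>m\<close>.\<close>

lemma nonexpansive_Fix_relax_le:
  fixes T :: "'b::real_inner \<Rightarrow> 'b"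
  assumes "nonexpansive T" and "p \<in> Fix T" and "0 \<le> m"
  shows "(norm (u + m *\<^sub>R (T u - u) - p))\<^sup>2 \<le> (norm (u - p))\<^sup>2 - m * (1 - m) * (norm (T u - u))\<^sup>2"
proof -
  have "norm (T u - p) \<le> norm (u - p)"
    using assms(1,2) by (metis (mono_tags) Fix_def mem_Collect_eq nonexpansive_def)
  then have le: "(norm (T u - p))\<^sup>2 \<le> (norm (u - p))\<^sup>2"
    by simp
  define v where "v = T u - u"
  define w where "w = u - p"
  have eqs: "T u - p = w + v" "u + m *\<^sub>R v - p = w + m *\<^sub>R v"
    by (simp_all add: v_def w_def)
  have sq: "(norm (w + r *\<^sub>R v))\<^sup>2 = (norm w)\<^sup>2 + r * (2 * (w \<bullet> v)) + r\<^sup>2 * (norm v)\<^sup>2" for r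
    unfolding power2_norm_eq_inner
    by (simp add: inner_simps inner_commute power2_eq_square algebra_simps)
  have "(norm (w + v))\<^sup>2 \<le> (norm w)\<^sup>2"
    using le unfolding eqs w_def[symmetric] .
  moreover have "(norm (w + v))\<^sup>2 = (norm w)\<^sup>2 + 2 * (w \<bullet> v) + (norm v)\<^sup>2"
    using sq[of 1] by simp
  ultimately have "2 * (w \<bullet> v) + (norm v)\<^sup>2 \<le> 0"
    by linarith
  then have "m * (2 * (w \<bullet> v) + (norm v)\<^sup>2) \<le> 0"
    using \<open>0 \<le> m\<close> by (intro mult_nonneg_nonpos)
  then have "(norm (w + m *\<^sub>R v))\<^sup>2 \<le> (norm w)\<^sup>2 - m * (1 - m) * (norm v)\<^sup>2"
    unfolding sq by (simp add: power2_eq_square algebra_simps)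
  then show ?thesis
    by (simp only: eqs flip: v_def w_def)
qed

section \<open>Estimates along the flow\<close>

text \<open>The residual \<open>norm (T u - u)\<close> is 2-Lipschitz, and an Euler step is a
  relaxation step with parameter \<open>h * lam r\<close> in [0,1], which does not increase
  it.\<close>

lemma nonexpansive_flow_residual_antimono:
  fixes x :: "real \<Rightarrow> 'b::real_inner"
  assumes T: "nonexpansive T" and lam: "\<And>t. 0 \<le> t \<Longrightarrow> lam t \<in> {0..1}"
    and sol: "strong_global_solution lam T x0 x" and "0 \<le> s" "s \<le> t"
  shows "norm (T (x t) - x t) \<le> norm (T (x s) - x s)"
proof -
  have "norm (T (x t) - x t) \<le> norm (T (x s) - x s) + 0 * (t - s)"
  proof (rule strong_global_solution_le[where \<phi> = "\<lambda>u. norm (T u - u)" and W = UNIV and K = 2,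
        OF sol \<open>0 \<le> s\<close> \<open>s \<le> t\<close>])
    fix u v
    have "\<bar>norm (T u - u) - norm (T v - v)\<bar> \<le> norm ((T u - u) - (T v - v))"
      by (rule norm_triangle_ineq3)
    also have "\<dots> = norm ((T u - T v) - (u - v))"
      by (simp add: algebra_simps)
    also have "\<dots> \<le> norm (T u - T v) + norm (u - v)"
      by (rule norm_triangle_ineq4)
    also have "\<dots> \<le> 2 * norm (u - v)"
      using T by (simp add: nonexpansive_def)
    finally show "\<bar>norm (T u - u) - norm (T v - v)\<bar> \<le> 2 * norm (u - v)" .
  next
    fix r h :: real assume "s \<le> r" "0 < h" "h < 1"
    then show "norm (T (x r + (h * lam r) *\<^sub>R (T (x r) - x r)) - (x r + (h * lam r) *\<^sub>R (T (x r) - x r)))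
        \<le> norm (T (x r) - x r) + 0 * h"
      using nonexpansive_residual_relax_le[OF T, of "h * lam r" "x r"] lam[of r] \<open>0 \<le> s\<close>
      by (simp add: mult_le_one)
  qed auto
  then show ?thesis by simp
qed

text \<open>Each Euler step moves by at most \<open>h\<close> times the current residual, which
  never exceeds the residual at time \<open>s\<close>.\<close>

lemma nonexpansive_flow_norm_diff_le:
  fixes x :: "real \<Rightarrow> 'b::real_inner"
  assumes T: "nonexpansive T" and lam: "\<And>t. 0 \<le> t \<Longrightarrow> lam t \<in> {0..1}"
    and sol: "strong_global_solution lam T x0 x" and "0 \<le> s" "s \<le> t"
  shows "norm (x t - x s) \<le> norm (T (x s) - x s) * (t - s)"
proof -
  have "norm (x t - x s) \<le> norm (x s - x s) + norm (T (x s) - x s) * (t - s)"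
  proof (rule strong_global_solution_le[where \<phi> = "\<lambda>u. norm (u - x s)" and W = UNIV and K = 1,
        OF sol \<open>0 \<le> s\<close> \<open>s \<le> t\<close>])
    show "\<bar>norm (u - x s) - norm (v - x s)\<bar> \<le> 1 * norm (u - v)" for u v
      using norm_triangle_ineq3[of "u - x s" "v - x s"] by simp
  next
    fix r h :: real assume r: "s \<le> r" "0 < h" "h < 1"
    have "norm ((h * lam r) *\<^sub>R (T (x r) - x r)) = h * lam r * norm (T (x r) - x r)"
      using r lam[of r] \<open>0 \<le> s\<close> by simp
    also have "\<dots> \<le> h * 1 * norm (T (x s) - x s)"
      using r lam[of r] \<open>0 \<le> s\<close> nonexpansive_flow_residual_antimono[OF T lam sol \<open>0 \<le> s\<close> r(1)]
      by (intro mult_mono) auto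
    finally show "norm (x r + (h * lam r) *\<^sub>R (T (x r) - x r) - x s)
        \<le> norm (x r - x s) + norm (T (x s) - x s) * h"
      using norm_triangle_ineq[of "x r - x s" "(h * lam r) *\<^sub>R (T (x r) - x r)"]
      by (simp add: algebra_simps)
  qed auto
  then show ?thesis by simp
qed

text \<open>Relaxation steps do not move away from fixed points. Besides the monotonicity of the
  energy, this confines the solution to a ball around \<open>p\<close>, as the energy estimate
  requires.\<close>

lemma nonexpansive_flow_Fejer:
  fixes x :: "real \<Rightarrow> 'b::real_inner"
  assumes T: "nonexpansive T" and lam: "\<And>t. 0 \<le> t \<Longrightarrow> lam t \<in> {0..1}"
    and sol: "strong_global_solution lam T x0 x" and "0 \<le> s" "s \<le> t" and p: "p \<in> Fix T"
  shows "norm (x t - p) \<le> norm (x s - p)"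
proof -
  have "norm (x t - p) \<le> norm (x s - p) + 0 * (t - s)"
  proof (rule strong_global_solution_le[where \<phi> = "\<lambda>u. norm (u - p)" and W = UNIV and K = 1,
        OF sol \<open>0 \<le> s\<close> \<open>s \<le> t\<close>])
    show "\<bar>norm (u - p) - norm (v - p)\<bar> \<le> 1 * norm (u - v)" for u v
      using norm_triangle_ineq3[of "u - p" "v - p"] by simp
  next
    fix r h :: real assume r: "s \<le> r" "0 < h" "h < 1"
    have "0 \<le> h * lam r" "h * lam r \<le> 1"
      using r lam[of r] \<open>0 \<le> s\<close> by (auto simp: mult_le_one)
    then have "0 \<le> h * lam r * (1 - h * lam r) * (norm (T (x r) - x r))\<^sup>2"
      by simp
    then have "(norm (x r + (h * lam r) *\<^sub>R (T (x r) - x r) - p))\<^sup>2 \<le> (norm (x r - p))\<^sup>2"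
      using nonexpansive_Fix_relax_le[OF T p \<open>0 \<le> h * lam r\<close>, of "x r"] by linarith
    then show "norm (x r + (h * lam r) *\<^sub>R (T (x r) - x r) - p) \<le> norm (x r - p) + 0 * h"
      by (simp add: power2_le_iff_abs_le)
  qed auto
  then show ?thesis by simp
qed

text \<open>An Euler step of length \<open>h\<close> lowers the squared distance to \<open>p\<close>
  by at least \<open>h * \<tau>\<close> times the squared residual at time \<open>r\<close>. The
  latter is bounded below by its value at the final time \<open>t\<close>, which gives a constant
  rate.\<close>

lemma nonexpansive_flow_energy_le:
  fixes x :: "real \<Rightarrow> 'b::real_inner"
  assumes T: "nonexpansive T" and lam: "\<And>t. 0 \<le> t \<Longrightarrow> lam t \<in> {0..1}"
    and sol: "strong_global_solution lam T x0 x" and "0 \<le> s" "s \<le> t" and p: "p \<in> Fix T"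
    and \<tau>: "0 \<le> \<tau>" "\<And>t. 0 \<le> t \<Longrightarrow> \<tau> \<le> lam t * (1 - lam t)"
  shows "\<tau> * (norm (T (x t) - x t))\<^sup>2 * (t - s) \<le> (norm (x s - p))\<^sup>2 - (norm (x t - p))\<^sup>2"
proof -
  \<comment> \<open>On the ball of radius \<open>R\<close> around \<open>p\<close> the squared
    distance is Lipschitz with constant \<open>2 * R\<close>.\<close>
  define R where "R = norm (x s - p)"
  have "(norm (x t - p))\<^sup>2 \<le> (norm (x s - p))\<^sup>2 + (- \<tau> * (norm (T (x t) - x t))\<^sup>2) * (t - s)"
  proof (rule strong_global_solution_le[where \<phi> = "\<lambda>u. (norm (u - p))\<^sup>2" and W = "cball p R" and K = "2 * R",
        OF sol \<open>0 \<le> s\<close> \<open>s \<le> t\<close>])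
    show inW: "x r \<in> cball p R" if "s \<le> r" for r
      using nonexpansive_flow_Fejer[OF T lam sol \<open>0 \<le> s\<close> that p]
      by (simp add: R_def dist_norm norm_minus_commute)
    fix u v assume "u \<in> cball p R" "v \<in> cball p R"
    then have uv: "norm (u - p) \<le> R" "norm (v - p) \<le> R"
      by (auto simp: dist_norm norm_minus_commute)
    have "\<bar>(norm (u - p))\<^sup>2 - (norm (v - p))\<^sup>2\<bar>
        = (norm (u - p) + norm (v - p)) * \<bar>norm (u - p) - norm (v - p)\<bar>"
      by (simp add: power2_eq_square square_diff_square_factored abs_mult)
    also have "\<dots> \<le> (2 * R) * norm (u - v)"
      using uv norm_triangle_ineq3[of "u - p" "v - p"]
      by (intro mult_mono) (auto simp: R_def)
    finally show "\<bar>(norm (u - p))\<^sup>2 - (norm (v - p))\<^sup>2\<bar> \<le> 2 * R * norm (u - v)" .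
  next
    fix r h :: real assume r: "s \<le> r" "r < t" "0 < h" "h < 1"
    define m where "m = h * lam r"
    have l: "0 \<le> lam r" "lam r \<le> 1"
      using lam[of r] r \<open>0 \<le> s\<close> by auto
    then have m: "0 \<le> m" "m \<le> lam r"
      using r by (auto simp: m_def mult_left_le_one_le)
    have "h * \<tau> \<le> h * (lam r * (1 - lam r))"
      using \<tau>(2)[of r] r \<open>0 \<le> s\<close> by (intro mult_left_mono) auto
    also have "\<dots> = m * (1 - lam r)"
      by (simp add: m_def)
    \<comment> \<open>Since \<open>h < 1\<close>, the step parameter \<open>m\<close> is at most
      \<open>lam r\<close>.\<close>
    also have "\<dots> \<le> m * (1 - m)"
      using m by (intro mult_left_mono) auto
    finally have "h * \<tau> \<le> m * (1 - m)" .
    moreover have "(norm (T (x t) - x t))\<^sup>2 \<le> (norm (T (x r) - x r))\<^sup>2"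
      using nonexpansive_flow_residual_antimono[OF T lam sol, of r t] r \<open>0 \<le> s\<close> by simp
    ultimately have "h * \<tau> * (norm (T (x t) - x t))\<^sup>2 \<le> m * (1 - m) * (norm (T (x r) - x r))\<^sup>2"
      by (rule mult_mono) (use m l in auto)
    then have main: "(norm (x r + m *\<^sub>R (T (x r) - x r) - p))\<^sup>2
        \<le> (norm (x r - p))\<^sup>2 - h * \<tau> * (norm (T (x t) - x t))\<^sup>2"
      using nonexpansive_Fix_relax_le[OF T p m(1), of "x r"] by linarith
    then show "(norm (x r + (h * lam r) *\<^sub>R (T (x r) - x r) - p))\<^sup>2
        \<le> (norm (x r - p))\<^sup>2 + (- \<tau> * (norm (T (x t) - x t))\<^sup>2) * h"
      by (simp add: m_def algebra_simps)
    have "norm (x r - p) \<le> R"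
      unfolding R_def by (rule nonexpansive_flow_Fejer[OF T lam sol \<open>0 \<le> s\<close> r(1) p])
    moreover have "0 \<le> h * \<tau> * (norm (T (x t) - x t))\<^sup>2"
      using r \<open>0 \<le> \<tau>\<close> by simp
    then have "(norm (x r + m *\<^sub>R (T (x r) - x r) - p))\<^sup>2 \<le> (norm (x r - p))\<^sup>2"
      using main by linarith
    then have "norm (x r + m *\<^sub>R (T (x r) - x r) - p) \<le> norm (x r - p)"
      by (simp add: power2_le_iff_abs_le)
    ultimately show "x r + (h * lam r) *\<^sub>R (T (x r) - x r) \<in> cball p R"
      by (simp add: m_def dist_norm norm_minus_commute)
  qed
  then show ?thesis by simp
qed

section \<open>Two limit facts: size of a derivative, halving the time\<close>

lemma has_vector_derivative_norm_le:
  fixes x :: "real \<Rightarrow> 'b::real_normed_vector"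
  assumes der: "(x has_vector_derivative v) (at t within S)" and lim: "at t within S \<noteq> bot"
    and le: "\<forall>\<^sub>F s in at t within S. norm (x s - x t) \<le> B * \<bar>s - t\<bar>"
  shows "norm v \<le> B"
proof -
  define q where "q s = norm (x s - x t - (s - t) *\<^sub>R v) / norm (s - t)" for s
  have "(q \<longlongrightarrow> 0) (at t within S)"
    using der by (simp add: q_def[abs_def] has_vector_derivative_def has_derivative_iff_norm)
  then have "((\<lambda>s. B + q s) \<longlongrightarrow> B + 0) (at t within S)"
    by (intro tendsto_intros)
  moreover have "\<forall>\<^sub>F s in at t within S. s \<noteq> t"
    by (simp add: eventually_at_filter)
  with le have "\<forall>\<^sub>F s in at t within S. norm v \<le> B + q s"
  proof eventually_elim
    case (elim s)
    have "\<bar>s - t\<bar> * norm v = norm ((x s - x t) - (x s - x t - (s - t) *\<^sub>R v))"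
      by simp
    also have "\<dots> \<le> norm (x s - x t) + norm (x s - x t - (s - t) *\<^sub>R v)"
      by (rule norm_triangle_ineq4)
    also have "norm (x s - x t - (s - t) *\<^sub>R v) = q s * \<bar>s - t\<bar>"
      using elim by (simp add: q_def)
    also have "norm (x s - x t) + q s * \<bar>s - t\<bar> \<le> \<bar>s - t\<bar> * (B + q s)"
      using elim by (simp add: algebra_simps)
    finally show ?case
      using elim by simp
  qed
  ultimately have "norm v \<le> B + 0"
    using lim by (rule tendsto_lowerbound)
  then show ?thesis by simp
qed

text \<open>A nonincreasing function bounded below converges to its infimum, so its values at
  \<open>t / 2\<close> and at \<open>t\<close> share the same limit.\<close>

lemma antimono_at_top_diff_half_tendsto:
  fixes E :: "real \<Rightarrow> real"
  assumes anti: "\<And>s t. 0 \<le> s \<Longrightarrow> s \<le> t \<Longrightarrow> E t \<le> E s" and nonneg: "\<And>t. 0 \<le> E t"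
  shows "((\<lambda>t. E (t / 2) - E t) \<longlongrightarrow> 0) at_top"
proof -
  define l where "l = (INF t\<in>{0..}. E t)"
  have bdd: "bdd_below (E ` {0..})"
    using nonneg by (auto intro!: bdd_belowI[of _ 0])
  have E: "(E \<longlongrightarrow> l) at_top"
  proof (rule decreasing_tendsto)
    show "\<forall>\<^sub>F t in at_top. l \<le> E t"
      using eventually_ge_at_top[of 0]
      by eventually_elim (auto simp: l_def intro: cINF_lower[OF bdd])
    fix y assume "l < y"
    then obtain s where s: "0 \<le> s" "E s < y"
      using cINF_less_iff[of "{0..}" E y] bdd by (auto simp: l_def)
    show "\<forall>\<^sub>F t in at_top. E t < y"
      using eventually_ge_at_top[of s] by eventually_elim (use anti s in force)
  qed
  moreover have "filterlim (\<lambda>t::real. t / 2) at_top at_top"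
    using filterlim_tendsto_pos_mult_at_top[OF tendsto_const[of "1/2"] _ filterlim_ident] by simp
  ultimately have "((\<lambda>t. E (t / 2)) \<longlongrightarrow> l) at_top"
    by (rule filterlim_compose)
  from tendsto_diff[OF this E] show ?thesis
    by simp
qed

section \<open>Decay rate of the residual\<close>

theorem theorem11:
  fixes T :: "'h::{real_inner, complete_space} \<Rightarrow> 'h"
    and lam :: "real \<Rightarrow> real"
    and x0 :: 'h
    and x :: "real \<Rightarrow> 'h"
    and \<tau> :: real
  assumes "nonexpansive T"
    and "Fix T \<noteq> {}"
    and "lam \<in> borel_measurable (lebesgue_on {0..})"
    and "\<forall>t\<ge>0. lam t \<in> {0..1}"
    and "0 < (INF t\<in>{0..}. lam t)"
    and "(INF t\<in>{0..}. lam t) \<le> (SUP t\<in>{0..}. lam t)"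
    and "(SUP t\<in>{0..}. lam t) < 1"
    and "strong_global_solution lam T x0 x"
    and "\<tau> = (INF t\<in>{0..}. lam t * (1 - lam t))"
  shows "0 < \<tau> \<and>
    (\<forall>t\<ge>0.
       (\<forall>v. (x has_vector_derivative v) (at t within {0..}) \<longrightarrow>
            t * (norm v)\<^sup>2 \<le> t * (norm (T (x t) - x t))\<^sup>2) \<and>
       set_integrable lebesgue {t/2..t} (\<lambda>s. lam s * (1 - lam s) * (norm (T (x s) - x s))\<^sup>2) \<and>
       t * (norm (T (x t) - x t))\<^sup>2 \<le>
         2 / \<tau> * (LINT s:{t/2..t}|lebesgue. lam s * (1 - lam s) * (norm (T (x s) - x s))\<^sup>2)) \<and>
    ((\<lambda>t. LINT s:{t/2..t}|lebesgue. lam s * (1 - lam s) * (norm (T (x s) - x s))\<^sup>2)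
       \<longlongrightarrow> 0) at_top"
proof -
  note T = assms(1) and sol = assms(8)
  obtain p where p: "p \<in> Fix T"
    using assms(2) by blast
  have lam: "lam t \<in> {0..1}" if "0 \<le> t" for t
    using assms(4) that by blast
  define y where "y t = (norm (T (x t) - x t))\<^sup>2" for t
  define I where "I t = lam t * (1 - lam t) * (norm (T (x t) - x t))\<^sup>2" for t
  have I_y: "I t = lam t * (1 - lam t) * y t" for t
    by (simp add: I_def y_def)
  have y0: "0 \<le> y t" for t
    by (simp add: y_def)
  have y_anti: "y t \<le> y s" if "0 \<le> s" "s \<le> t" for s t
    using nonexpansive_flow_residual_antimono[OF T lam sol that] by (simp add: y_def)

  have lam_bdd: "bdd_below (lam ` {0..})" "bdd_above (lam ` {0..})"
    using lam by (auto intro!: bdd_belowI[of _ 0] bdd_aboveI[of _ 1])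
  \<comment> \<open>This product is a positive lower bound for the weight, hence for its infimum
    \<open>\<tau>\<close>.\<close>
  have "(INF t\<in>{0..}. lam t) * (1 - (SUP t\<in>{0..}. lam t)) \<le> lam t * (1 - lam t)" if "0 \<le> t" for t
    using that lam[OF that] assms(5,7) cINF_lower[OF lam_bdd(1), of t] cSUP_upper[OF _ lam_bdd(2), of t]
    by (intro mult_mono) auto
  then have "(INF t\<in>{0..}. lam t) * (1 - (SUP t\<in>{0..}. lam t)) \<le> \<tau>"
    unfolding assms(9) by (intro cINF_greatest) auto
  moreover have "0 < (INF t\<in>{0..}. lam t) * (1 - (SUP t\<in>{0..}. lam t))"
    using assms(5,7) by simp
  ultimately have \<tau>_pos: "0 < \<tau>"
    by linarith
  have "bdd_below ((\<lambda>t. lam t * (1 - lam t)) ` {0..})"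
    using lam by (fastforce intro!: bdd_belowI[of _ 0])
  then have \<tau>_le: "\<tau> \<le> lam t * (1 - lam t)" if "0 \<le> t" for t
    using cINF_lower[of "\<lambda>t. lam t * (1 - lam t)" "{0..}" t] that by (simp add: assms(9))

  \<comment> \<open>Continuity of \<open>x\<close>, and with it of \<open>y\<close>, provides the
    measurability of the integrand. The Lipschitz constant is the initial residual, the largest
    speed bound.\<close>
  have contx: "continuous_on {0..} x"
  proof (rule lipschitz_on_continuous_on)
    show "(norm (T (x 0) - x 0))-lipschitz_on {0..} x"
    proof (rule lipschitz_on_leI)
      fix s t :: real assume "s \<in> {0..}" "t \<in> {0..}" "s \<le> t"
      then show "dist (x s) (x t) \<le> norm (T (x 0) - x 0) * dist s t"
        using nonexpansive_flow_norm_diff_le[OF T lam sol, of s t]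
          mult_right_mono[OF nonexpansive_flow_residual_antimono[OF T lam sol, of 0 s], of "t - s"]
        by (simp add: dist_norm norm_minus_commute)
    qed simp
  qed
  have "continuous_on UNIV T"
    using T by (intro lipschitz_on_continuous_on[of 1] lipschitz_onI) (auto simp: nonexpansive_def dist_norm)
  then have "continuous_on {0..} (\<lambda>t. T (x t))"
    using contx by (rule continuous_on_compose2) auto
  then have conty: "continuous_on {0..} y"
    unfolding y_def by (intro continuous_intros contx)
  have I_meas: "I \<in> borel_measurable (lebesgue_on {0..})"
    unfolding I_y using conty assms(3)
    by (auto intro!: borel_measurable_times borel_measurable_diff
        intro: continuous_imp_measurable_on_sets_lebesgue)
  have I_bounds: "\<tau> * y b \<le> I s" "I s \<le> y a" if "0 \<le> a" "s \<in> {a..b}" for a b s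
  proof -
    have s: "0 \<le> s" "a \<le> s" "s \<le> b"
      using that by auto
    show "\<tau> * y b \<le> I s"
      unfolding I_y using \<tau>_le[of s] y_anti[of s b] s \<tau>_pos y0 lam[of s]
      by (intro mult_mono) auto
    have "lam s * (1 - lam s) * y s \<le> 1 * y a"
      using y_anti[of a s] y0 lam[of s] s that(1) by (intro mult_mono) (auto intro: mult_le_one)
    then show "I s \<le> y a"
      by (simp add: I_y)
  qed
  have I_int: "I absolutely_integrable_on {a..b}" if "0 \<le> a" for a b
  proof (rule measurable_bounded_by_integrable_imp_absolutely_integrable)
    show "I \<in> borel_measurable (lebesgue_on {a..b})"
      by (rule measurable_restrict_mono[OF I_meas]) (use that in auto)
    show "(\<lambda>_. y a) integrable_on {a..b}"
      by (rule integrable_const_ivl)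
    show "norm (I s) \<le> y a" if s: "s \<in> {a..b}" for s
    proof -
      have "0 \<le> I s"
        using I_bounds(1)[OF \<open>0 \<le> a\<close> s] mult_nonneg_nonneg[OF less_imp_le[OF \<tau>_pos] y0[of b]] by linarith
      then show ?thesis
        using I_bounds(2)[OF \<open>0 \<le> a\<close> s] by simp
    qed
  qed auto
  define J where "J t = (LINT s:{t/2..t}|lebesgue. I s)" for t
  \<comment> \<open>The interval has length \<open>t / 2\<close>, and monotonicity of
    \<open>y\<close> bounds the integrand by constants taken from its endpoints.\<close>
  have J_bounds: "\<tau> * (t * y t) \<le> 2 * J t" "2 * J t \<le> t * y (t / 2)" if "0 \<le> t" for t
  proof -
    have J: "J t = integral {t/2..t} I" "I integrable_on {t/2..t}"
      using set_lebesgue_integral_eq_integral[OF I_int[of "t/2" t]] that by (auto simp: J_def)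
    have "integral {t/2..t} (\<lambda>_. \<tau> * y t) \<le> J t"
      unfolding J(1) by (rule integral_le[OF integrable_const_ivl J(2)]) (use I_bounds(1)[of "t/2" _ t] that in simp)
    moreover have "J t \<le> integral {t/2..t} (\<lambda>_. y (t/2))"
      unfolding J(1)
      by (rule integral_le[OF J(2) integrable_const_ivl]) (use I_bounds(2)[of "t/2" _ t] that in simp)
    ultimately show "\<tau> * (t * y t) \<le> 2 * J t" "2 * J t \<le> t * y (t / 2)"
      using that by (auto simp: algebra_simps)
  qed

  \<comment> \<open>The increment bound starting at \<open>t\<close> concerns later times, so the
    derivative is restricted to the right of \<open>t\<close>; this also covers the one-sided
    derivative at 0.\<close>
  have "norm v \<le> norm (T (x t) - x t)"
    if "0 \<le> t" and v: "(x has_vector_derivative v) (at t within {0..})" for t v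
  proof (rule has_vector_derivative_norm_le)
    show "(x has_vector_derivative v) (at t within {t..})"
      by (rule has_vector_derivative_within_subset[OF v]) (use that in auto)
    show "at t within {t..} \<noteq> bot"
      by (simp add: at_within_Ici_at_right)
    show "\<forall>\<^sub>F s in at t within {t..}. norm (x s - x t) \<le> norm (T (x t) - x t) * \<bar>s - t\<bar>"
      using nonexpansive_flow_norm_diff_le[OF T lam sol \<open>0 \<le> t\<close>]
      by (auto simp: eventually_at_filter)
  qed
  then have deriv: "t * (norm v)\<^sup>2 \<le> t * (norm (T (x t) - x t))\<^sup>2"
    if "0 \<le> t" and "(x has_vector_derivative v) (at t within {0..})" for t v
    using that by (intro mult_left_mono power_mono) auto
  have rate: "t * y t \<le> 2 / \<tau> * J t" if "0 \<le> t" for t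
    using J_bounds(1)[OF that] \<tau>_pos by (simp add: field_simps)

  define E where "E t = (norm (x t - p))\<^sup>2" for t
  have "((\<lambda>t. E (t / 2) - E t) \<longlongrightarrow> 0) at_top"
    using nonexpansive_flow_Fejer[OF T lam sol _ _ p]
    by (intro antimono_at_top_diff_half_tendsto) (auto simp: E_def)
  moreover have "filterlim (\<lambda>t::real. t / 2) at_top at_top"
    using filterlim_tendsto_pos_mult_at_top[OF tendsto_const[of "1/2"] _ filterlim_ident] by simp
  ultimately have "((\<lambda>t. E (t / 2 / 2) - E (t / 2)) \<longlongrightarrow> 0) at_top"
    by (rule filterlim_compose)
  then have lim: "((\<lambda>t. 2 / \<tau> * (E (t / 2 / 2) - E (t / 2))) \<longlongrightarrow> 0) at_top"
    by (rule tendsto_mult_right_zero)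
  have "(J \<longlongrightarrow> 0) at_top"
  proof (rule tendsto_sandwich[OF _ _ tendsto_const lim])
    show "\<forall>\<^sub>F t in at_top. 0 \<le> J t"
      using eventually_ge_at_top[of 0]
    proof eventually_elim
      case (elim t)
      then have "0 \<le> \<tau> * (t * y t)"
        using \<tau>_pos y0 by simp
      with J_bounds(1)[OF elim] show ?case by linarith
    qed
    show "\<forall>\<^sub>F t in at_top. J t \<le> 2 / \<tau> * (E (t / 2 / 2) - E (t / 2))"
      using eventually_ge_at_top[of 0]
    proof eventually_elim
      case (elim t)
      \<comment> \<open>The upper bound for \<open>J t\<close> involves \<open>y (t / 2)\<close>, so
        the energy drop is taken over the preceding interval from \<open>t / 4\<close> to
        \<open>t / 2\<close>.\<close>
      have "\<tau> * y (t / 2) * (t / 2 - t / 2 / 2) \<le> E (t / 2 / 2) - E (t / 2)"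
        unfolding y_def E_def using elim \<tau>_pos
        by (intro nonexpansive_flow_energy_le[OF T lam sol _ _ p _ \<tau>_le]) auto
      then have "t * y (t / 2) \<le> 2 * (2 / \<tau> * (E (t / 2 / 2) - E (t / 2)))"
        using \<tau>_pos by (simp add: field_simps)
      with J_bounds(2)[OF elim] show ?case by linarith
    qed
  qed
  then show ?thesis
    using \<tau>_pos deriv rate I_int unfolding I_def[abs_def] J_def[abs_def] y_def by simp
qed

end
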